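(* Let $v = [x_1,x_2,x_3][x_4,x_5] \in \mathbb{Z}\langle X\rangle$. Then $3\,v \in T^{(4)}$ but $v \notin T^{(4)}$.
   Context: $\mathbb{Z}\langle X\rangle$ is the free unitary associative ring (noncommutative polynomials with integer coefficients) freely generated by the infinite countable set $X=\{x_1,x_2,\dots\}$. Commutators are left-normed: $[a,b]=ab-ba$, $[a,b,c]=[[a,b],c]$, and in general $[a_1,\dots,a_n]=[[a_1,\dots,a_{n-1}],a_n]$. $T^{(4)}$ is the two-sided ideal of $\mathbb{Z}\langle X\rangle$ generated by all commutators $[a_1,a_2,a_3,a_4]$ with $a_i\in\mathbb{Z}\langle X\rangle$. *)

theory Defs
  imports "HOL-Library.Poly_Mapping" "HOL-Algebra.Algebraic_Closure_Type"
begin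

text \<open>
  The free monoid of words, written additively because the convolution product on
  \<^typ>\<open>'k \<Rightarrow>\<^sub>0 'r\<close> is the monoid-ring product for an additively written monoid of keys.
\<close>

datatype 'a free_monoid = Word "'a list"

instantiation free_monoid :: (type) monoid_add
begin

definition zero_free_monoid :: "'a free_monoid" where
  "0 = Word []"

fun plus_free_monoid :: "'a free_monoid \<Rightarrow> 'a free_monoid \<Rightarrow> 'a free_monoid" where
  "Word u + Word w = Word (u @ w)"

instance
proof
  fix a b c :: "'a free_monoid"
  show "a + b + c = a + (b + c)" by (cases a; cases b; cases c) simp
  show "0 + a = a" by (cases a) (simp add: zero_free_monoid_def)
  show "a + 0 = a" by (cases a) (simp add: zero_free_monoid_def)
qed

end

text \<open>
  \<open>\<int>\<langle>X\<rangle>\<close> is the monoid ring over \<open>\<int>\<close> of the free monoid on \<open>X\<close>, with the countably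
  infinite set \<open>X\<close> indexed by \<^typ>\<open>nat\<close>.
\<close>

type_synonym ZX = "nat free_monoid \<Rightarrow>\<^sub>0 int"

definition x :: "nat \<Rightarrow> ZX" where
  "x i = Poly_Mapping.single (Word [i]) 1"

definition comm :: "'a::ring \<Rightarrow> 'a \<Rightarrow> 'a" where
  "comm a b = a * b - b * a"

text \<open>Left-normed commutators \<open>[a\<^sub>1, \<dots>, a\<^sub>n]\<close>; the value on the empty list is junk.\<close>

fun lcomm :: "'a::ring list \<Rightarrow> 'a" where
  "lcomm [] = 0"
| "lcomm (a # as) = foldl comm a as"

lemma lcomm_simps:
  "lcomm [a, b] = a * b - b * a"
  "as \<noteq> [] \<Longrightarrow> lcomm (as @ [b]) = comm (lcomm as) b"
  by (simp add: comm_def) (cases as; simp)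

text \<open>
  The following makes \<^const>\<open>genideal\<close> meaningful here: \<^const>\<open>ideal\<close> presupposes a ring,
  and the library has this fact only for commutative rings.
\<close>

lemma (in ring_1) ring_of_type_algebra_ring:
  "ring (ring_of_type_algebra :: 'a ring)"
proof -
  have "\<exists>y. z + y = 0" for z :: 'a
    using add.right_inverse by blast
  thus ?thesis
    unfolding ring_of_type_algebra_def using add.right_inverse
    by unfold_locales (auto simp: algebra_simps Units_def)
qed

definition T4 :: "ZX set" where
  "T4 = genideal ring_of_type_algebra {lcomm [a\<^sub>1, a\<^sub>2, a\<^sub>3, a\<^sub>4] | a\<^sub>1 a\<^sub>2 a\<^sub>3 a\<^sub>4. True}"

end

theory Submission
  imports Defs
begin

text \<open>
  Write \<open>F(a,b,c,d,e) = [a,b,c][d,e]\<close>. Modulo \<open>T\<^sup>(\<^sup>4\<^sup>)\<close> every commutator of length three is central,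
  because \<open>[[a,b,c],r] = [a,b,c,r]\<close>. Feeding products into a commutator of length four then gives
  relations on \<open>F\<close>: expanding \<open>[a,b,cd,e]\<close> leaves \<open>F(a,b,c,d,e) + F(a,b,d,c,e)\<close>
  (\<open>comm32_swap34\<close>), and expanding \<open>[ac,d,b,e]\<close> leaves, after the first relation has cancelled four of
  the six terms, \<open>F(a,b,c,d,e) + F(c,b,a,d,e)\<close> (\<open>comm32_swap13\<close>). Together with the antisymmetry of
  the commutator this makes \<open>F\<close> alternating in all five arguments. In particular it is invariant under
  the cyclic rotation of \<open>a,b,c\<close>, so the Jacobi identity
  \<open>F(a,b,c,d,e) + F(b,c,a,d,e) + F(c,a,b,d,e) = 0\<close> reads \<open>3F = 0\<close>.

  That \<open>v = F(x\<^sub>1,\<dots>,x\<^sub>5)\<close> itself lies outside \<open>T\<^sup>(\<^sup>4\<^sup>)\<close> is shown by a linear functional on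
  \<open>\<int>\<langle>X\<rangle>\<close> that is divisible by 3 on \<open>T\<^sup>(\<^sup>4\<^sup>)\<close> but not at \<open>v\<close>. Since \<open>v\<close> is multilinear, only the 120
  words that are permutations of \<open>x\<^sub>1,\<dots>,x\<^sub>5\<close> need to carry a weight. Symmetry cuts the search down:
  permuting the variables multiplies \<open>v\<close> by the sign of the permutation modulo \<open>T\<^sup>(\<^sup>4\<^sup>)\<close>, so a
  functional modulo 3 that vanishes on \<open>T\<^sup>(\<^sup>4\<^sup>)\<close> may be averaged, with signs, over any group of permutations whose order is prime
  to 3 without changing its value at \<open>v\<close>. Read the indices modulo 5 and take the group of the 20 affine
  maps \<open>i \<mapsto> ai + b\<close>; the sign of such a map is the quadratic character of \<open>a\<close>. The group acts freely on
  the 120 words, so six values remain to be chosen, and a solution supported on only two of the six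
  orbits exists: the orbit of \<open>0,1,2,4,3\<close> with value \<open>-1\<close> and the orbit of \<open>1,0,2,4,3\<close> with value \<open>1\<close>
  there. By multilinearity, divisibility by 3 on \<open>T\<^sup>(\<^sup>4\<^sup>)\<close> has to be verified only for
  \<open>u[a,b,c,d]v\<close> with words \<open>u,a,b,c,d,v\<close> that multiply to one of the 120 words. As a commutator with
  an empty word is zero, five letters can be cut in just six ways, which is a finite computation
  (\<open>vanishing_at_listing\<close>).
\<close>

section \<open>Products of a triple and a double commutator modulo a Lie nilpotent ideal\<close>

locale lie_nilpotent_quotient =
  fixes I :: "'a::ring_1 set"
  assumes ideal_I: "ideal I ring_of_type_algebra"
    and lcomm4_in: "lcomm [a, b, c, d] \<in> I"
begin

lemma diff_in: "u \<in> I \<Longrightarrow> w \<in> I \<Longrightarrow> u - w \<in> I"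
proof -
  assume u: "u \<in> I" and w: "w \<in> I"
  interpret ideal I ring_of_type_algebra by (rule ideal_I)
  have "- 1 * w \<in> I" using I_l_closed[OF w, of "- 1"] by (simp add: ring_of_type_algebra_def)
  then show ?thesis using additive_subgroup.a_closed[OF is_additive_subgroup u, of "- 1 * w"]
    by (simp add: ring_of_type_algebra_def)
qed

lemma zero_in: "0 \<in> I"
  using diff_in lcomm4_in by (metis diff_self)

lemma minus_in: "u \<in> I \<Longrightarrow> - u \<in> I"
  using diff_in[OF zero_in] by simp

lemma add_in: "u \<in> I \<Longrightarrow> w \<in> I \<Longrightarrow> u + w \<in> I"
  using diff_in[OF _ minus_in] by force

lemma mult_left_in: "u \<in> I \<Longrightarrow> r * u \<in> I"
  using ideal.I_l_closed[OF ideal_I, of u r] by (simp add: ring_of_type_algebra_def)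

lemma mult_right_in: "u \<in> I \<Longrightarrow> u * r \<in> I"
  using ideal.I_r_closed[OF ideal_I, of u r] by (simp add: ring_of_type_algebra_def)

lemmas closed = zero_in diff_in minus_in add_in mult_left_in mult_right_in lcomm4_in

definition comm32 where "comm32 a b c d e = lcomm [a, b, c] * lcomm [d, e]"

lemma comm32_swap12: "comm32 b a c d e = - comm32 a b c d e"
  by (simp add: comm32_def comm_def algebra_simps)

lemma comm32_swap45: "comm32 a b c e d = - comm32 a b c d e"
  by (simp add: comm32_def comm_def algebra_simps)

lemma comm32_jacobi: "comm32 a b c d e + comm32 b c a d e + comm32 c a b d e = 0"
  by (simp add: comm32_def comm_def algebra_simps)

text \<open>
  Expand \<open>[u, cd, e]\<close> with \<open>u = [a,b]\<close> by the Leibniz rule: apart from \<open>[u,c,e]d\<close> and \<open>c[u,d,e]\<close> it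
  consists of \<open>[u,c][d,e] + [c,e][u,d]\<close>. Moving the central factor \<open>[u,d]\<close> to the front costs
  \<open>[[u,d],[c,e]]\<close>, which is a difference of two commutators of length five.
\<close>

lemma comm32_swap34: "comm32 a b c d e + comm32 a b d c e \<in> I"
proof -
  have "comm32 a b c d e + comm32 a b d c e
      = lcomm [a, b, c * d, e] - lcomm [a, b, c, e] * d - c * lcomm [a, b, d, e]
        + (lcomm [a, b, d, c, e] - lcomm [a, b, d, e, c])"
    by (simp add: comm32_def comm_def algebra_simps)
  moreover have "lcomm [a, b, d, c, e] \<in> I" "lcomm [a, b, d, e, c] \<in> I"
    using lcomm4_in[of "comm a b" d] by simp_all
  ultimately show ?thesis
    by (metis closed)
qed

lemma comm_lcomm3_in: "comm (lcomm [a, b, c]) r \<in> I"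
  using lcomm4_in[of a b c r] by simp

text \<open>
  Expanding \<open>[ac,d,b,e]\<close> by the Leibniz rule leaves six products of a commutator of length three and
  one of length two. By \<open>comm32_swap34\<close> they are alternating in the last three arguments; this
  cancels the two pairs with equal first two arguments and turns the other two into the claim.
\<close>

lemma comm32_swap13: "comm32 a b c d e + comm32 c b a d e \<in> I"
proof -
  have *: "comm32 c d b a e + comm32 a b e c d + comm32 c d e a b
      + comm32 a d e c b + comm32 c b e a d + comm32 a d b c e \<in> I"
  proof -
    have "comm32 c d b a e + comm32 a b e c d + comm32 c d e a b
        + comm32 a d e c b + comm32 c b e a d + comm32 a d b c e
      = lcomm [a * c, d, b, e] - a * lcomm [c, d, b, e] - lcomm [a, d, b, e] * c
        + comm (lcomm [c, d, b]) (comm a e) + comm (lcomm [c, d, e]) (comm a b)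
        + comm (lcomm [c, b, e]) (comm a d)"
      by (simp add: comm32_def comm_def algebra_simps)
    then show ?thesis
      by (metis closed comm_lcomm3_in)
  qed
  have "comm32 a b c d e + comm32 c b a d e =
    (comm32 c d b a e + comm32 a b e c d + comm32 c d e a b
      + comm32 a d e c b + comm32 c b e a d + comm32 a d b c e)
    - (comm32 c d b a e + comm32 c d a b e) - (comm32 c d e a b + comm32 c d a e b)
    - (comm32 a d e c b + comm32 a d c e b) - (comm32 a d b c e + comm32 a d c b e)
    - (comm32 a b e c d + comm32 a b c e d) - (comm32 c b e a d + comm32 c b a e d)"
    using comm32_swap45[of a b c e d] comm32_swap45[of c b a e d]
      comm32_swap45[of a d c e b] comm32_swap45[of c d a e b]
    by simp
  then show ?thesis
    by (metis * closed comm32_swap34)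
qed

text \<open>
  Modulo \<open>I\<close> the three terms of the Jacobi identity agree: each rotation of \<open>a, b, c\<close> is a product
  of the exchange of the first two arguments and that of the first and the third.
\<close>

lemma three_comm32_in: "3 * comm32 a b c d e \<in> I"
proof -
  have "3 * comm32 a b c d e
    = (comm32 a b c d e + comm32 c b a d e) - (comm32 c a b d e + comm32 b a c d e)
      + (comm32 a b c d e + comm32 b c a d e + comm32 c a b d e)"
  proof -
    have three: "3 * z = z + z + z" for z :: 'a
      using distrib_right[of 1 1 z] distrib_right[of "1 + 1" 1 z] by simp
    show ?thesis
      using comm32_swap12[of a b c d e] comm32_swap12[of b c a d e] comm32_swap12[of c a b d e]
      by (simp add: three)
  qed
  then show ?thesis
    by (metis closed comm32_jacobi comm32_swap13)
qed

end

section \<open>A weight on multilinear words\<close>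

text \<open>
  Modulo 5, with \<open>a = q - p\<close>, the conditions say that \<open>r = p + 2a\<close> and \<open>s = p + 4a\<close>. On a
  permutation of \<open>1,\<dots>,5\<close> they force \<open>t = p + 3a\<close>, so the word is the image of \<open>0,1,2,4,3\<close> (zero
  followed by the powers of 2) under the affine map \<open>i \<mapsto> ai + p\<close>. The value is the quadratic
  character of \<open>a\<close>. The equations are arranged so that no subtraction of natural numbers occurs.
\<close>

fun geometric_sign :: "nat list \<Rightarrow> int" where
  "geometric_sign [p, q, r, s, t] =
    (if (r + p) mod 5 = (2 * q) mod 5 then if (s + 3 * p) mod 5 = (4 * q) mod 5
     then if (q + 4 * p) mod 5 \<in> {1, 4} then 1 else - 1 else 0 else 0)"
| "geometric_sign _ = 0"

text \<open>
  Exchanging the first two letters turns \<open>0,1,2,4,3\<close> into \<open>1,0,2,4,3\<close>. When \<open>q # p # w\<close> is the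
  affine image of \<open>0,1,2,4,3\<close>, then \<open>p # q # w\<close> is the image of \<open>1,0,2,4,3\<close> under the same map.
  So on permutations of \<open>1,\<dots>,5\<close> the two terms are the indicators of two orbits, each multiplied by the quadratic character.
\<close>

fun weight :: "nat list \<Rightarrow> int" where
  "weight (p # q # w) = geometric_sign (q # p # w) - geometric_sign (p # q # w)"
| "weight _ = 0"

definition multilinear_words :: "nat list set" where
  "multilinear_words = {w. length w = 5 \<and> set w = {1..5}}"

lemma finite_multilinear_words: "finite multilinear_words"
  unfolding multilinear_words_def
  by (rule finite_subset[OF _ finite_lists_length_eq[of "{1..5}" 5]]) auto

definition multilinear_weight :: "nat list \<Rightarrow> int" where
  "multilinear_weight w = (if w \<in> multilinear_words then weight w else 0)"

text \<open>The value of the linear extension of \<open>f\<close> at \<open>p[a,b,c,d]q\<close>, for words.\<close>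

definition comm_sum ::
  "('a list \<Rightarrow> int) \<Rightarrow> 'a list \<Rightarrow> 'a list \<Rightarrow> 'a list \<Rightarrow> 'a list \<Rightarrow> 'a list \<Rightarrow> 'a list \<Rightarrow> int"
  where "comm_sum f p a b c d q =
     f (p@a@b@c@d@q) - f (p@b@a@c@d@q) - f (p@c@a@b@d@q) + f (p@c@b@a@d@q)
   - f (p@d@a@b@c@q) + f (p@d@b@a@c@q) + f (p@d@c@a@b@q) - f (p@d@c@b@a@q)"

text \<open>The six ways to cut \<open>p q r s t\<close> into \<open>u,a,b,c,d,v\<close> with \<open>a,b,c,d\<close> nonempty.\<close>

definition vanishing_at :: "nat list \<Rightarrow> bool" where
  "vanishing_at w \<longleftrightarrow> (case w of [p, q, r, s, t] \<Rightarrow>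
    (\<forall>(u, a, b, c, d, v) \<in> set
      [([p],[q],[r],[s],[t],[]), ([],[p],[q],[r],[s],[t]), ([],[p,q],[r],[s],[t],[]),
       ([],[p],[q,r],[s],[t],[]), ([],[p],[q],[r,s],[t],[]), ([],[p],[q],[r],[s,t],[])].
      3 dvd comm_sum weight u a b c d v) | _ \<Rightarrow> True)"

text \<open>
  The quantifiers run through the 120 permutations of \<open>1,\<dots>,5\<close> letter by letter, so that the
  computation does not visit words with repeated letters.
\<close>

lemma vanishing_at_listing:
  "\<forall>p\<in>set [1..<6]. \<forall>q\<in>set (remove1 p [1..<6]).
   \<forall>r\<in>set (remove1 q (remove1 p [1..<6])).
   \<forall>s\<in>set (remove1 r (remove1 q (remove1 p [1..<6]))).
   \<forall>t\<in>set (remove1 s (remove1 r (remove1 q (remove1 p [1..<6])))).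
     vanishing_at [p, q, r, s, t]"
  by code_simp

lemma vanishing_at_multilinear:
  assumes "w \<in> multilinear_words"
  shows "vanishing_at w"
proof -
  have "distinct w" using assms by (intro card_distinct) (simp add: multilinear_words_def)
  moreover obtain p q r s t where w: "w = [p, q, r, s, t]"
    using assms by (auto simp: multilinear_words_def numeral_eq_Suc length_Suc_conv)
  moreover have "{p, q, r, s, t} = set [1..<6]"
  proof -
    have "set [1..<6] = {1..5::nat}" by auto
    moreover have "set w = {1..5}" using assms unfolding multilinear_words_def by blast
    ultimately show ?thesis unfolding w by simp
  qed
  ultimately have "p \<in> set [1..<6]" "q \<in> set (remove1 p [1..<6])"
    "r \<in> set (remove1 q (remove1 p [1..<6]))"
    "s \<in> set (remove1 r (remove1 q (remove1 p [1..<6])))"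
    "t \<in> set (remove1 s (remove1 r (remove1 q (remove1 p [1..<6]))))"
    by (auto simp only: distinct_upt set_remove1_eq distinct_remove1 distinct.simps list.set)
  with vanishing_at_listing w show ?thesis by blast
qed

lemma three_dvd_comm_sum: "3 dvd comm_sum multilinear_weight u a b c d v"
proof -
  \<comment> \<open>All eight words in the expansion have the same letters, so either all of them are multilinear
    or none is.\<close>
  have multilinear_weight: "multilinear_weight w
      = (if u @ a @ b @ c @ d @ v \<in> multilinear_words then weight w else 0)"
    if "mset w = mset (u @ a @ b @ c @ d @ v)" for w
    using mset_eq_setD[OF that] mset_eq_length[OF that]
    unfolding multilinear_weight_def multilinear_words_def mem_Collect_eq by (simp only:)
  have *: "comm_sum multilinear_weight u a b c d v
      = (if u @ a @ b @ c @ d @ v \<in> multilinear_words then comm_sum weight u a b c d v else 0)"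
    unfolding comm_sum_def by (simp add: multilinear_weight ac_simps del: weight.simps)
  consider "u @ a @ b @ c @ d @ v \<notin> multilinear_words"
    | "a = [] \<or> b = [] \<or> c = [] \<or> d = []"
    | "u @ a @ b @ c @ d @ v \<in> multilinear_words" "a \<noteq> []" "b \<noteq> []" "c \<noteq> []" "d \<noteq> []"
    by blast
  then show ?thesis
  proof cases
    case 1
    then show ?thesis by (simp add: *)
  next
    case 2
    then show ?thesis
      by (elim disjE) (simp_all add: comm_sum_def del: weight.simps)
  next
    case 3
    then obtain a1 a2 b1 b2 c1 c2 d1 d2
      where ne: "a = a1 # a2" "b = b1 # b2" "c = c1 # c2" "d = d1 # d2"
      by (meson neq_Nil_conv)
    have "length (u @ a @ b @ c @ d @ v) = 5" using 3(1) unfolding multilinear_words_def by blast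
    then have "length u + length a2 + length b2 + length c2 + length d2 + length v = 1"
      by (simp add: ne)
    then consider z where "u = [z]" "a2 = []" "b2 = []" "c2 = []" "d2 = []" "v = []"
      | z where "u = []" "a2 = [z]" "b2 = []" "c2 = []" "d2 = []" "v = []"
      | z where "u = []" "a2 = []" "b2 = [z]" "c2 = []" "d2 = []" "v = []"
      | z where "u = []" "a2 = []" "b2 = []" "c2 = [z]" "d2 = []" "v = []"
      | z where "u = []" "a2 = []" "b2 = []" "c2 = []" "d2 = [z]" "v = []"
      | z where "u = []" "a2 = []" "b2 = []" "c2 = []" "d2 = []" "v = [z]"
      by (auto simp: add_is_1 length_Suc_conv)
    then show ?thesis
      using vanishing_at_multilinear[OF 3(1)] unfolding * if_P[OF 3(1)]
      by cases (simp_all add: vanishing_at_def ne del: weight.simps)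
  qed
qed

section \<open>The functional on the free ring\<close>

definition weight_sum :: "ZX \<Rightarrow> int" where
  "weight_sum f = (\<Sum>w\<in>multilinear_words. weight w * Poly_Mapping.lookup f (Word w))"

lemma weight_sum_diff: "weight_sum (f - g) = weight_sum f - weight_sum g"
  by (simp add: weight_sum_def lookup_minus right_diff_distrib sum_subtractf)

lemma weight_sum_add: "weight_sum (f + g) = weight_sum f + weight_sum g"
  by (simp add: weight_sum_def lookup_add distrib_left sum.distrib)

lemma weight_sum_single: "weight_sum (Poly_Mapping.single (Word w) 1) = multilinear_weight w"
proof -
  have "weight_sum (Poly_Mapping.single (Word w) 1)
      = (\<Sum>u\<in>multilinear_words. if u = w then weight u else 0)"
    unfolding weight_sum_def by (rule sum.cong) (auto simp: lookup_single when_def)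
  then show ?thesis
    using finite_multilinear_words by (simp add: multilinear_weight_def)
qed

lemma ZX_induct:
  assumes "\<And>w. P (Poly_Mapping.single (Word w) 1)" "\<And>f g. P f \<Longrightarrow> P g \<Longrightarrow> P (f - g)"
  shows "P (f :: ZX)"
proof (induction f rule: frag_induction[OF subset_UNIV])
  case 1
  then show ?case using assms(2)[OF assms(1)[of undefined] assms(1)[of undefined]] by simp
next
  case (2 k)
  then show ?case using assms(1) by (cases k) simp
qed (rule assms(2))

lemma comm_diff: "comm (a - b) c = comm a c - comm b c" "comm c (a - b) = comm c a - comm c b"
  by (simp_all add: comm_def algebra_simps)

text \<open>
  The expression is linear in each of its six arguments, which are therefore generalised from words
  to arbitrary elements one at a time.
\<close>

lemma three_dvd_weight_sum: "3 dvd weight_sum (u * lcomm [a, b, c, d] * v)"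
proof -
  let ?W = "\<lambda>w. Poly_Mapping.single (Word w) 1 :: ZX"
  note linear = comm_diff left_diff_distrib right_diff_distrib weight_sum_diff
  have "3 dvd weight_sum (?W u * lcomm [?W a, ?W b, ?W c, ?W d] * ?W v)" for u a b c d v
    using three_dvd_comm_sum[of u a b c d v]
    by (simp add: comm_def mult_single algebra_simps weight_sum_add weight_sum_diff
        weight_sum_single comm_sum_def)
  then have "3 dvd weight_sum (u * lcomm [?W a, ?W b, ?W c, ?W d] * ?W v)" for u a b c d v
    by (induction u rule: ZX_induct) (simp_all add: linear)
  then have "3 dvd weight_sum (u * lcomm [a, ?W b, ?W c, ?W d] * ?W v)" for u a b c d v
    by (induction a rule: ZX_induct) (simp_all add: linear)
  then have "3 dvd weight_sum (u * lcomm [a, b, ?W c, ?W d] * ?W v)" for u a b c d v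
    by (induction b rule: ZX_induct) (simp_all add: linear)
  then have "3 dvd weight_sum (u * lcomm [a, b, c, ?W d] * ?W v)" for u a b c d v
    by (induction c rule: ZX_induct) (simp_all add: linear)
  then have "3 dvd weight_sum (u * lcomm [a, b, c, d] * ?W v)" for u a b c d v
    by (induction d rule: ZX_induct) (simp_all add: linear)
  then show ?thesis
    by (induction v rule: ZX_induct) (simp_all add: linear)
qed

text \<open>
  The elements at which the functional is divisible by 3 need not form an ideal. Those all of whose
  two-sided multiples have this property do, and \<open>three_dvd_weight_sum\<close> puts the
  generators of \<open>T\<^sup>(\<^sup>4\<^sup>)\<close> into that ideal.
\<close>

lemma ideal_weight_sum:
  "ideal {f. \<forall>u v. 3 dvd weight_sum (u * f * v)} (ring_of_type_algebra :: ZX ring)"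
proof -
  let ?R = "ring_of_type_algebra :: ZX ring"
  let ?J = "{f. \<forall>u v. 3 dvd weight_sum (u * f * v)}"
  interpret ring ?R by (rule ring_of_type_algebra_ring)
  have neg: "\<ominus>\<^bsub>?R\<^esub> f = - f" for f
    by (rule minus_equality) (simp_all add: ring_of_type_algebra_def)
  have zero: "weight_sum 0 = 0"
    by (simp add: weight_sum_def)
  show ?thesis
  proof (rule idealI[OF ring_axioms])
    show "subgroup ?J (add_monoid ?R)"
    proof (rule group.subgroupI[OF add.is_group])
      show "?J \<noteq> {}" by (auto intro!: exI[of _ 0] simp: zero)
      show "inv\<^bsub>add_monoid ?R\<^esub> f \<in> ?J" if "f \<in> ?J" for f
        using that neg[of f] weight_sum_diff[of 0] by (simp add: a_inv_def zero)
    qed (auto simp: ring_of_type_algebra_def distrib_left distrib_right weight_sum_add)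
  next
    fix f g :: ZX
    assume f: "f \<in> ?J"
    show "g \<otimes>\<^bsub>?R\<^esub> f \<in> ?J"
      using f by (simp add: ring_of_type_algebra_def flip: mult.assoc)
    show "f \<otimes>\<^bsub>?R\<^esub> g \<in> ?J"
      using f by (simp add: ring_of_type_algebra_def) (simp add: mult.assoc)
  qed
qed

section \<open>The additive order of the product modulo \<open>T\<^sup>(\<^sup>4\<^sup>)\<close>\<close>

lemma lie_nilpotent_quotient_T4: "lie_nilpotent_quotient T4"
proof (rule lie_nilpotent_quotient.intro)
  interpret ring "ring_of_type_algebra :: ZX ring" by (rule ring_of_type_algebra_ring)
  show "ideal T4 ring_of_type_algebra"
    unfolding T4_def by (rule genideal_ideal) (simp add: ring_of_type_algebra_def)
  show "lcomm [a, b, c, d] \<in> T4" for a b c d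
    unfolding T4_def by (rule subsetD[OF genideal_self]) (auto simp: ring_of_type_algebra_def)
qed

lemma three_dvd_weight_sum_T4: "f \<in> T4 \<Longrightarrow> 3 dvd weight_sum f"
proof -
  assume f: "f \<in> T4"
  interpret ring "ring_of_type_algebra :: ZX ring" by (rule ring_of_type_algebra_ring)
  have "T4 \<subseteq> {f. \<forall>u v. 3 dvd weight_sum (u * f * v)}"
    unfolding T4_def by (rule genideal_minimal[OF ideal_weight_sum])
      (use three_dvd_weight_sum in blast)
  with f show ?thesis
    by (metis (mono_tags, lifting) mem_Collect_eq mult_1 mult_1_right subsetD)
qed

lemma not_three_dvd_weight_sum: "\<not> 3 dvd weight_sum (lcomm [x 1, x 2, x 3] * lcomm [x 4, x 5])"
proof -
  have "weight_sum (lcomm [x 1, x 2, x 3] * lcomm [x 4, x 5])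
    = multilinear_weight [1, 2, 3, 4, 5] - multilinear_weight [2, 1, 3, 4, 5]
    - multilinear_weight [3, 1, 2, 4, 5] + multilinear_weight [3, 2, 1, 4, 5]
    - multilinear_weight [1, 2, 3, 5, 4] + multilinear_weight [2, 1, 3, 5, 4]
    + multilinear_weight [3, 1, 2, 5, 4] - multilinear_weight [3, 2, 1, 5, 4]"
    by (simp add: x_def comm_def mult_single algebra_simps weight_sum_add weight_sum_diff
        weight_sum_single)
  also have "\<dots>
    = weight [1, 2, 3, 4, 5] - weight [2, 1, 3, 4, 5]
    - weight [3, 1, 2, 4, 5] + weight [3, 2, 1, 4, 5]
    - weight [1, 2, 3, 5, 4] + weight [2, 1, 3, 5, 4]
    + weight [3, 1, 2, 5, 4] - weight [3, 2, 1, 5, 4]"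
  proof -
    have "multilinear_weight w = weight w" if "mset w = mset [1, 2, 3, 4, 5]" for w
    proof -
      have "{1, 2, 3, 4, 5} = {1..5::nat}" by auto
      then show ?thesis
        using mset_eq_setD[OF that] mset_eq_length[OF that]
        by (simp add: multilinear_weight_def multilinear_words_def)
    qed
    then show ?thesis by (simp del: weight.simps add: add_mset_commute)
  qed
  also have "\<not> 3 dvd \<dots>"
    by code_simp
  finally show ?thesis .
qed

theorem theorem1p1:
  shows "let v = lcomm [x 1, x 2, x 3] * lcomm [x 4, x 5]
         in 3 * v \<in> T4 \<and> v \<notin> T4"
  using not_three_dvd_weight_sum three_dvd_weight_sum_T4
    lie_nilpotent_quotient.three_comm32_in
      [OF lie_nilpotent_quotient_T4, of "x 1" "x 2" "x 3" "x 4" "x 5"]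
  unfolding Let_def lie_nilpotent_quotient.comm32_def[OF lie_nilpotent_quotient_T4] by blast

end
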